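(* Let $k$ be a field of characteristic $2$ and let $C/k$ be an elliptic curve in $\mu_4$-normal form, i.e. for some $s\in k$, $$(X_0+X_2)^2=X_1X_3,\qquad s(X_1+X_3)^2=X_0X_2,$$ in $\mathbb{P}^3$, with identity $\mathrm{O}=(1:1:0:1)$. The duplication morphism $[2]:C\to C$ is given by $(X_0:X_1:X_2:X_3)\mapsto(Z_0:Z_1:Z_2:Z_3)$ with $$\begin{aligned}Z_0&=(X_0+X_2)^4,\\ Z_1&=(X_0+X_2)^4+s^2(X_1+X_3)^4+(X_0+X_3)^2(X_1+X_2)^2,\\ Z_2&=s(X_1+X_3)^4,\\ Z_3&=(X_0+X_2)^4+s^2(X_1+X_3)^4+(X_0+X_1)^2(X_2+X_3)^2,\end{aligned}$$ and duplication on $C$ can be carried out in $2\mathbf{M}+5\mathbf{S}+2\mathbf{m}_s$.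
   Context: Duplication means computing projective coordinates of $2P$ from projective coordinates of $P\in C$. Costs: $\mathbf{M}$ is a multiplication in $k$, $\mathbf{S}$ a squaring in $k$, $\mathbf{m}_s$ a multiplication by a fixed constant depending only on the curve ($s$ or a bounded power of $s$); field additions and the precomputation of constants are not counted. An elliptic curve is nonsingular, so $s\neq 0$. *)

theory Defs
  imports
    "HOL-Algebra.Algebraic_Closure_Type"
    "HOL-Computational_Algebra.Formal_Power_Series"
begin

section \<open>The projective curve\<close>

type_synonym 'a quad = "'a \<times> 'a \<times> 'a \<times> 'a"

fun map_quad :: "('a \<Rightarrow> 'b) \<Rightarrow> 'a quad \<Rightarrow> 'b quad" where
  "map_quad h (x0, x1, x2, x3) = (h x0, h x1, h x2, h x3)"

abbreviation scale :: "'a::times \<Rightarrow> 'a quad \<Rightarrow> 'a quad" where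
  "scale c \<equiv> map_quad ((*) c)"

text \<open>The point of projective 3-space with homogeneous coordinates \<open>x\<close> (for nonzero \<open>x\<close>).\<close>

definition pt :: "'a::field quad \<Rightarrow> 'a quad set" where
  "pt x = {scale c x | c. c \<noteq> 0}"

text \<open>The equations are stated over commutative rings, since they are also used over \<open>k[[t]]\<close>.\<close>

fun mu4_equations :: "'a::comm_ring_1 \<Rightarrow> 'a quad \<Rightarrow> bool" where
  "mu4_equations s (x0, x1, x2, x3) \<longleftrightarrow>
     (x0 + x2)^2 = x1 * x3 \<and> s * (x1 + x3)^2 = x0 * x2"

definition curve_coords :: "'a::field \<Rightarrow> 'a quad set" where
  "curve_coords s = {x. x \<noteq> (0, 0, 0, 0) \<and> mu4_equations s x}"

definition curve_points :: "'a::field \<Rightarrow> 'a quad set set" where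
  "curve_points s = pt ` curve_coords s"

definition origin :: "'a::field quad set" where
  "origin = pt (1, 1, 0, 1)"

text \<open>
  Jacobian criterion: at every point the gradients of \<open>(x\<^sub>0 + x\<^sub>2)\<^sup>2 - x\<^sub>1 x\<^sub>3\<close> and
  \<open>s (x\<^sub>1 + x\<^sub>3)\<^sup>2 - x\<^sub>0 x\<^sub>2\<close> are linearly independent. It is meant to be used over an
  algebraically closed field. A nonsingular intersection of two quadrics in projective
  3-space is a connected curve of genus 1, so nonsingularity is all that is needed for an
  elliptic curve with the rational point \<open>origin\<close>.
\<close>

fun gradient1 :: "'a::field quad \<Rightarrow> 'a quad" where
  "gradient1 (x0, x1, x2, x3) = (2 * (x0 + x2), - x3, 2 * (x0 + x2), - x1)"

fun gradient2 :: "'a::field \<Rightarrow> 'a quad \<Rightarrow> 'a quad" where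
  "gradient2 s (x0, x1, x2, x3) = (- x2, 2 * s * (x1 + x3), - x0, 2 * s * (x1 + x3))"

fun add_quad :: "'a::plus quad \<Rightarrow> 'a quad \<Rightarrow> 'a quad" where
  "add_quad (x0, x1, x2, x3) (y0, y1, y2, y3) = (x0 + y0, x1 + y1, x2 + y2, x3 + y3)"

definition nonsingular_curve :: "'a::field \<Rightarrow> bool" where
  "nonsingular_curve s \<longleftrightarrow>
     (\<forall>x \<in> curve_coords s. \<forall>a b.
        add_quad (scale a (gradient1 x)) (scale b (gradient2 s x)) = (0, 0, 0, 0)
        \<longrightarrow> a = 0 \<and> b = 0)"


section \<open>Divisors of rational functions and the group law\<close>

text \<open>
  A form of degree \<open>d\<close> in four variables over \<open>'a\<close> is given by its coefficients; only the
  values at exponents of total degree \<open>d\<close> matter. It is evaluated at quadruples of power series.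
\<close>

definition exponents :: "nat \<Rightarrow> nat quad set" where
  "exponents d = {(a, b, c, e). a + b + c + e = d}"

fun eval_form :: "nat \<Rightarrow> (nat quad \<Rightarrow> 'a::field) \<Rightarrow> 'a fps quad \<Rightarrow> 'a fps" where
  "eval_form d F (g0, g1, g2, g3) =
     (\<Sum>(a, b, c, e) \<in> exponents d. fps_const (F (a, b, c, e)) * g0^a * g1^b * g2^c * g3^e)"

text \<open>
  A formal parametrisation of the curve at the point with coordinates \<open>x\<close>, with nonzero
  velocity (in projective space). At a nonsingular point such parametrisations exist, and
  each identifies the completed local ring with \<open>k[[t]]\<close>; hence the order in \<open>t\<close> of a form
  along it is the order of vanishing at the point, independently of the parametrisation.
\<close>

definition local_param :: "'a::field \<Rightarrow> 'a quad \<Rightarrow> 'a fps quad \<Rightarrow> bool" where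
  "local_param s x g \<longleftrightarrow>
     mu4_equations (fps_const s) g \<and>
     map_quad (\<lambda>f. fps_nth f 0) g = x \<and>
     (\<nexists>c. map_quad (\<lambda>f. fps_nth f 1) g = scale c x)"

text \<open>
  The divisor \<open>D\<close> on the curve is the divisor of a rational function, written as a quotient of
  two forms of equal degree neither of which vanishes identically on the curve. For
  this to be the usual notion the field has to be algebraically closed and the curve nonsingular.
\<close>

definition principal_divisor :: "'a::alg_closed_field \<Rightarrow> ('a quad set \<Rightarrow> int) \<Rightarrow> bool" where
  "principal_divisor s D \<longleftrightarrow>
     (\<exists>d F G. \<forall>x \<in> curve_coords s. \<forall>g. local_param s x g \<longrightarrow>
        eval_form d F g \<noteq> 0 \<and> eval_form d G g \<noteq> 0 \<and>
        D (pt x) = int (subdegree (eval_form d F g)) - int (subdegree (eval_form d G g)))"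

text \<open>
  The group law with identity \<open>O = origin\<close>: \<open>R = P + Q\<close> iff \<open>(P) + (Q) - (R) - (O)\<close> is
  principal, i.e. \<open>((P) - (O)) + ((Q) - (O)) = (R) - (O)\<close> in the Picard group.
\<close>

definition is_sum ::
  "'a::alg_closed_field \<Rightarrow> 'a quad set \<Rightarrow> 'a quad set \<Rightarrow> 'a quad set \<Rightarrow> bool" where
  "is_sum s P Q R \<longleftrightarrow>
     P \<in> curve_points s \<and> Q \<in> curve_points s \<and> R \<in> curve_points s \<and>
     principal_divisor s
       (\<lambda>T. of_bool (T = P) + of_bool (T = Q) - of_bool (T = R) - of_bool (T = origin))"

abbreviation is_double :: "'a::alg_closed_field \<Rightarrow> 'a quad set \<Rightarrow> 'a quad set \<Rightarrow> bool" where
  "is_double s P R \<equiv> is_sum s P P R"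

fun dup_forms :: "'a::comm_ring_1 \<Rightarrow> 'a quad \<Rightarrow> 'a quad" where
  "dup_forms s (x0, x1, x2, x3) =
     ((x0 + x2)^4,
      (x0 + x2)^4 + s^2 * (x1 + x3)^4 + (x0 + x3)^2 * (x1 + x2)^2,
      s * (x1 + x3)^4,
      (x0 + x2)^4 + s^2 * (x1 + x3)^4 + (x0 + x1)^2 * (x2 + x3)^2)"


section \<open>Straight-line programs and their cost\<close>

text \<open>
  Arguments are register numbers; each instruction appends its result as a new register.
  \<open>MulS e i\<close> multiplies register \<open>i\<close> by the constant \<open>s^e\<close>.
\<close>

datatype instr = Add nat nat | Mul nat nat | Sqr nat | MulS nat nat

fun instr_value :: "'a::field \<Rightarrow> 'a list \<Rightarrow> instr \<Rightarrow> 'a" where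
  "instr_value s rs (Add i j) = rs ! i + rs ! j"
| "instr_value s rs (Mul i j) = rs ! i * rs ! j"
| "instr_value s rs (Sqr i) = (rs ! i)^2"
| "instr_value s rs (MulS e i) = s^e * rs ! i"

definition run :: "'a::field \<Rightarrow> instr list \<Rightarrow> 'a list \<Rightarrow> 'a list" where
  "run s prog rs = foldl (\<lambda>rs ins. rs @ [instr_value s rs ins]) rs prog"

text \<open>
  \<open>n\<close> is the number of available registers. The admissible curve constants are \<open>s\<close> and \<open>s^2\<close>.
\<close>

fun valid_instr :: "nat \<Rightarrow> instr \<Rightarrow> bool" where
  "valid_instr n (Add i j) \<longleftrightarrow> i < n \<and> j < n"
| "valid_instr n (Mul i j) \<longleftrightarrow> i < n \<and> j < n"
| "valid_instr n (Sqr i) \<longleftrightarrow> i < n"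
| "valid_instr n (MulS e i) \<longleftrightarrow> e \<in> {1, 2} \<and> i < n"

fun valid_prog :: "nat \<Rightarrow> instr list \<Rightarrow> bool" where
  "valid_prog n [] \<longleftrightarrow> True"
| "valid_prog n (ins # prog) \<longleftrightarrow> valid_instr n ins \<and> valid_prog (Suc n) prog"

text \<open>A program on four inputs, together with the four registers holding the output.\<close>

type_synonym quad_prog = "instr list \<times> nat quad"

fun valid_quad_prog :: "quad_prog \<Rightarrow> bool" where
  "valid_quad_prog (prog, (i0, i1, i2, i3)) \<longleftrightarrow>
     valid_prog 4 prog \<and> (\<forall>i \<in> {i0, i1, i2, i3}. i < 4 + length prog)"

fun run_quad :: "'a::field \<Rightarrow> quad_prog \<Rightarrow> 'a quad \<Rightarrow> 'a quad" where
  "run_quad s (prog, out) (x0, x1, x2, x3) =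
     map_quad (\<lambda>i. run s prog [x0, x1, x2, x3] ! i) out"

text \<open>The numbers of general multiplications, squarings, and multiplications by constants.\<close>

fun cost :: "quad_prog \<Rightarrow> nat \<times> nat \<times> nat" where
  "cost (prog, out) =
     (length (filter (\<lambda>ins. \<exists>i j. ins = Mul i j) prog),
      length (filter (\<lambda>ins. \<exists>i. ins = Sqr i) prog),
      length (filter (\<lambda>ins. \<exists>e i. ins = MulS e i) prog))"

end

theory Submission
  imports Defs
begin

text \<open>
  Let \<open>P = pt x\<close> be a point different from \<open>O\<close>, and \<open>R\<close> the point computed by the duplication
  forms. Negation swaps \<open>x1\<close> and \<open>x3\<close>. The plane \<open>F\<close> through \<open>O\<close> and the tangent line at \<open>P\<close>
  should meet the curve in \<open>2 P + O + (-R)\<close>, and a suitable plane \<open>M\<close> in \<open>2 O + R + (-R)\<close>, so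
  that \<open>F / M\<close> has divisor \<open>2 P - R - O\<close>. Intersection multiplicities are obtained without
  Bezout's theorem: if \<open>F'\<close> is the plane \<open>F\<close> for \<open>-P\<close>, and \<open>L\<close> the plane cutting out
  \<open>2 O + P + (-P)\<close>, then \<open>F F' X2 = L\<^sup>2 M\<close> on the curve. The orders of \<open>L\<close>, \<open>M\<close> and \<open>X2\<close> can be
  computed directly, and away from \<open>O\<close> and the point of order 2, at most one of \<open>F\<close> and \<open>F'\<close>
  vanishes at a given point, so that the identity determines the order of \<open>F\<close>.
\<close>

section \<open>Arithmetic in characteristic 2\<close>

lemma char_2_add_self:
  fixes x :: "'a::comm_ring_1"
  assumes "(2::'a) = 0"
  shows "x + x = 0" "x + (x + y) = y" "- x = x"
proof -
  show "x + x = 0"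
    using assms by (metis mult_2 mult_zero_left)
  then show "x + (x + y) = y" "- x = x"
    by (simp_all add: add.assoc [symmetric] minus_unique)
qed

lemma fps_2_eq_0:
  assumes "(2::'a::field) = 0"
  shows "(2::'a fps) = 0"
  using assms by (simp add: numeral_fps_const)

lemma char_2_add_eq_0_iff:
  fixes x :: "'a::comm_ring_1"
  assumes "(2::'a) = 0"
  shows "x + y = 0 \<longleftrightarrow> x = y"
  using char_2_add_self [OF assms] by (metis add_eq_0_iff)

lemma char_2_square_add:
  fixes x :: "'a::comm_ring_1"
  assumes "(2::'a) = 0"
  shows "(x + y)^2 = x^2 + y^2"
  using assms by (simp add: power2_sum)

section \<open>Orders of power series\<close>

text \<open>Since \<open>subdegree 0 = 0\<close>, the zero series has to be excluded
  separately.\<close>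

definition has_ord :: "'a::field fps \<Rightarrow> nat \<Rightarrow> bool" where
  "has_ord f n \<longleftrightarrow> f \<noteq> 0 \<and> subdegree f = n"

lemma has_ord_0: "fps_nth f 0 \<noteq> 0 \<Longrightarrow> has_ord f 0"
  by (auto simp: has_ord_def)

lemma has_ord_1: "fps_nth f 0 = 0 \<Longrightarrow> fps_nth f 1 \<noteq> 0 \<Longrightarrow> has_ord f 1"
  unfolding has_ord_def by (auto intro!: subdegreeI)

lemma has_ord_unique: "has_ord f m \<Longrightarrow> has_ord f n \<Longrightarrow> m = n"
  by (simp add: has_ord_def)

lemma has_ord_mult: "has_ord f m \<Longrightarrow> has_ord g n \<Longrightarrow> has_ord (f * g) (m + n)"
  by (auto simp: has_ord_def)

lemma has_ord_power2: "has_ord f n \<Longrightarrow> has_ord (f\<^sup>2) (2 * n)"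
  by (auto simp: has_ord_def)

lemma has_ord_cancel: "has_ord (f * g) n \<Longrightarrow> has_ord f m \<Longrightarrow> has_ord g (n - m)"
  by (auto simp: has_ord_def)

lemma has_ord_fps_const: "c \<noteq> 0 \<Longrightarrow> has_ord (fps_const c) 0"
  by (simp add: has_ord_0)

section \<open>Points, negation and linear forms\<close>

lemma pt_eq_iff:
  fixes x y :: "'a::field quad"
  shows "pt x = pt y \<longleftrightarrow> (\<exists>c. c \<noteq> 0 \<and> y = scale c x)"
proof
  assume "pt x = pt y"
  moreover have "y \<in> pt y"
    unfolding pt_def by (cases y) (auto intro!: exI [of _ 1])
  ultimately show "\<exists>c. c \<noteq> 0 \<and> y = scale c x"
    by (auto simp: pt_def)
next
  assume "\<exists>c. c \<noteq> 0 \<and> y = scale c x"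
  then obtain c where c: "c \<noteq> 0" "y = scale c x" by blast
  have "scale d y = scale (d * c) x" "scale d x = scale (d / c) y" for d
    using c by (cases x; simp)+
  then show "pt x = pt y"
    unfolding pt_def using c(1) by (smt (verit) Collect_cong divide_eq_0_iff mult_eq_0_iff)
qed

fun neg :: "'a quad \<Rightarrow> 'a quad" where
  "neg (x0, x1, x2, x3) = (x0, x3, x2, x1)"

fun dot :: "'a::comm_ring_1 quad \<Rightarrow> 'a quad \<Rightarrow> 'a" where
  "dot (l0, l1, l2, l3) (x0, x1, x2, x3) = l0 * x0 + l1 * x1 + l2 * x2 + l3 * x3"

lemma dot_scale: "dot l (scale c x) = c * dot l x"
  by (cases l; cases x) (simp add: algebra_simps)

lemma dot_eq_0_cong: "pt x = pt y \<Longrightarrow> dot l y = 0 \<Longrightarrow> dot l x = 0"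
  by (metis dot_scale mult_eq_0_iff pt_eq_iff)

text \<open>On the curve, the plane \<open>chord x\<close> cuts out \<open>2 O + P + (-P)\<close>, where \<open>P = pt x \<noteq> O\<close>.\<close>

fun chord :: "'a::comm_ring_1 quad \<Rightarrow> 'a quad" where
  "chord (x0, x1, x2, x3) = (0, x2, x1 + x3, x2)"

text \<open>The plane through \<open>O\<close> and the tangent line at \<open>P\<close> (zero if \<open>P = O\<close>).\<close>

fun tangent_plane :: "'a::comm_ring_1 quad \<Rightarrow> 'a quad" where
  "tangent_plane (x0, x1, x2, x3) = ((x1 + x3) * x2, x2 * x3, (x1 + x3) * x0, x1 * x2)"

text \<open>
  This is \<open>chord (dup_forms s x)\<close> divided by \<open>(x1 + x3)\<^sup>2\<close>, which keeps it nonzero when \<open>P\<close> is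
  the point of order 2.
\<close>

fun double_chord :: "'a::comm_ring_1 \<Rightarrow> 'a quad \<Rightarrow> 'a quad" where
  "double_chord s (x0, x1, x2, x3) = (0, s * (x1 + x3)^2, (x0 + x2)^2, s * (x1 + x3)^2)"

section \<open>Polynomial identities on the curve\<close>

lemma tangent_plane_times_neg:
  fixes s :: "'a::comm_ring_1"
  assumes two: "(2::'a) = 0"
    and "mu4_equations s (x0, x1, x2, x3)" "mu4_equations s (y0, y1, y2, y3)"
  shows "dot (tangent_plane (x0, x1, x2, x3)) (y0, y1, y2, y3)
      * dot (tangent_plane (neg (x0, x1, x2, x3))) (y0, y1, y2, y3) * y2
    = (dot (chord (x0, x1, x2, x3)) (y0, y1, y2, y3))^2
      * dot (double_chord s (x0, x1, x2, x3)) (y0, y1, y2, y3)"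
proof -
  have x: "x1 * x3 = x0^2 + x2^2" "s * (x1 + x3)^2 = x0 * x2"
    and y: "y1 * y3 = y0^2 + y2^2" "s * (y1 + y3)^2 = y0 * y2"
    using assms by (simp_all add: char_2_square_add [OF two])
  \<comment> \<open>The two planes take the values \<open>x2 * A + u * B\<close> and
    \<open>x2 * A' + u * B\<close> at \<open>y\<close>. The sum and product of \<open>A\<close> and
    \<open>A'\<close> are symmetric in \<open>y1, y3\<close>, so the curve equations apply to them.
    \<open>L\<close> is the square of the chord's value.\<close>
  define u v A A' B L where defs: "u = x1 + x3" "v = y1 + y3" "A = x3 * y1 + x1 * y3"
    "A' = x1 * y1 + x3 * y3" "B = x2 * y0 + x0 * y2" "L = x2^2 * v^2 + u^2 * y2^2"
  note sq = char_2_square_add [OF two] power_mult_distrib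
  have sum: "A + A' = u * v"
    by (simp add: defs algebra_simps)
  have "A * A' = (x1 * x3) * (y1^2 + y3^2) + (x1^2 + x3^2) * (y1 * y3)"
    by (simp add: defs algebra_simps power2_eq_square)
  then have prod: "A * A' = (x0^2 + x2^2) * v^2 + u^2 * (y0^2 + y2^2)"
    unfolding x y by (simp add: defs sq)
  have B2: "B^2 = x2^2 * y0^2 + x0^2 * y2^2"
    by (simp add: defs sq)
  \<comment> \<open>The factor \<open>y2\<close> makes the second curve equation of both points
    applicable, which yields a multiple of \<open>L\<close>.\<close>
  have "x2 * B * y2 = x2^2 * (y0 * y2) + (x0 * x2) * y2^2"
    by (simp add: defs algebra_simps power2_eq_square)
  also have "\<dots> = s * L"
    unfolding x(2) [symmetric] y(2) [symmetric] by (simp add: defs algebra_simps)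
  finally have xBy: "x2 * B * y2 = s * L" .
  have "(x2 * A + u * B) * (x2 * A' + u * B)
      = x2^2 * (A * A') + x2 * u * B * (A + A') + u^2 * B^2"
    by (simp add: algebra_simps power2_eq_square)
  also have "\<dots> = (x0^2 + x2^2) * L + u^2 * v * (x2 * B) + 2 * (u^2 * x2^2 * y0^2)
      + (x2^2 * u^2 * y2^2 - x2^2 * u^2 * y2^2)"
    unfolding sum prod B2 by (simp add: defs(6) algebra_simps power2_eq_square)
  finally have "(x2 * A + u * B) * (x2 * A' + u * B) * y2
      = (x0^2 + x2^2) * L * y2 + u^2 * v * (x2 * B * y2)"
    using two by (simp add: algebra_simps)
  also have "\<dots> = L * (s * u^2 * v + (x0 + x2)^2 * y2)"
    unfolding xBy by (simp add: sq algebra_simps)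
  also have "L = (x2 * v + u * y2)^2"
    by (simp add: defs(6) sq)
  finally show ?thesis
    by (simp add: defs(1-5) algebra_simps)
qed

text \<open>By the curve equations every summand of \<open>Z1\<close> and \<open>Z3\<close> is a
  square, so each of them is the square of a sum.\<close>

lemma dup_forms_on_curve:
  fixes s :: "'a::comm_ring_1"
  assumes two: "(2::'a) = 0" and "mu4_equations s (x0, x1, x2, x3)"
  shows "dup_forms s (x0, x1, x2, x3)
    = ((x0 + x2)^4, (x0 * x1 + x2 * x3)^2, s * (x1 + x3)^4, (x0 * x3 + x1 * x2)^2)"
proof -
  have x: "(x0 + x2)^2 = x1 * x3" "s * (x1 + x3)^2 = x0 * x2"
    using assms(2) by simp_all
  have *: "(x0 + x2)^4 = (x1 * x3)^2" "s^2 * (x1 + x3)^4 = (x0 * x2)^2"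
    unfolding x [symmetric] by (simp_all add: power_mult_distrib)
  note char2 = char_2_add_self [OF two]
  have "x1 * x3 + x0 * x2 + (x0 + x3) * (x1 + x2) = x0 * x1 + x2 * x3"
    "x1 * x3 + x0 * x2 + (x0 + x1) * (x2 + x3) = x0 * x3 + x1 * x2"
    by (simp_all add: algebra_simps char2)
  then show ?thesis
    using * by (simp add: power_mult_distrib [symmetric] char_2_square_add [OF two, symmetric])
qed

text \<open>In \<open>Z1 + Z3\<close> the common terms cancel, leaving the square of
  \<open>(x0 + x2) * (x1 + x3)\<close>.\<close>

lemma dup_forms_chord:
  fixes s :: "'a::comm_ring_1"
  assumes two: "(2::'a) = 0"
  shows "chord (dup_forms s (x0, x1, x2, x3))
    = scale ((x1 + x3)^2) (double_chord s (x0, x1, x2, x3))"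
proof -
  note char2 = char_2_add_self [OF two]
  have "(x0 + x3) * (x1 + x2) + (x0 + x1) * (x2 + x3) = (x0 + x2) * (x1 + x3)"
    by (simp add: algebra_simps char2)
  then have "((x0 + x3) * (x1 + x2))^2 + ((x0 + x1) * (x2 + x3))^2 = ((x0 + x2) * (x1 + x3))^2"
    by (simp add: char_2_square_add [OF two, symmetric])
  then have *: "(x0 + x3)^2 * (x1 + x2)^2 + (x0 + x1)^2 * (x2 + x3)^2 = (x1 + x3)^2 * (x0 + x2)^2"
    by (simp add: power_mult_distrib mult.commute)
  have "(a + b + c) + (a + b + d) = c + d" for a b c d :: 'a
    by (simp add: char2 ac_simps)
  then show ?thesis
    using * by (simp add: power4_eq_xxxx power2_eq_square mult_ac)
qed

text \<open>The square roots of \<open>Z1\<close> and \<open>Z3\<close> have product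
  \<open>Z0 + Z2\<close> and sum \<open>(x0 + x2) * (x1 + x3)\<close>; taking powers gives the two
  equations.\<close>

lemma mu4_equations_dup_forms:
  fixes s :: "'a::comm_ring_1"
  assumes two: "(2::'a) = 0" and x: "mu4_equations s (x0, x1, x2, x3)"
  shows "mu4_equations s (dup_forms s (x0, x1, x2, x3))"
proof -
  have eqs: "x1 * x3 = (x0 + x2)^2" "x0 * x2 = s * (x1 + x3)^2"
    using x by simp_all
  note sq = char_2_square_add [OF two] power_mult_distrib
  have "(x0 * x1 + x2 * x3) * (x0 * x3 + x1 * x2)
      = (x0^2 + x2^2) * (x1 * x3) + (x0 * x2) * (x1^2 + x3^2)"
    by (simp add: algebra_simps power2_eq_square)
  also have "\<dots> = (x0 + x2)^4 + s * (x1 + x3)^4"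
    unfolding eqs char_2_square_add [OF two, symmetric]
    by (simp add: power4_eq_xxxx power2_eq_square mult_ac)
  finally have "((x0 + x2)^4 + s * (x1 + x3)^4)^2 = (x0 * x1 + x2 * x3)^2 * (x0 * x3 + x1 * x2)^2"
    by (simp add: power_mult_distrib [symmetric])
  moreover have "x0 * x1 + x2 * x3 + (x0 * x3 + x1 * x2) = (x0 + x2) * (x1 + x3)"
    by (simp add: algebra_simps)
  then have "s * ((x0 * x1 + x2 * x3)^2 + (x0 * x3 + x1 * x2)^2)^2
      = s * (((x0 + x2) * (x1 + x3))^2)^2"
    by (simp add: char_2_square_add [OF two, symmetric])
  then have "s * ((x0 * x1 + x2 * x3)^2 + (x0 * x3 + x1 * x2)^2)^2
      = (x0 + x2)^4 * (s * (x1 + x3)^4)"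
    by (simp add: power_mult_distrib mult_ac)
  ultimately show ?thesis
    unfolding dup_forms_on_curve [OF two x] by simp
qed

lemma tangent_plane_neg_dup:
  fixes s :: "'a::comm_ring_1"
  assumes two: "(2::'a) = 0" and x: "mu4_equations s (x0, x1, x2, x3)"
  shows "dot (tangent_plane (x0, x1, x2, x3)) (neg (dup_forms s (x0, x1, x2, x3))) = 0"
proof -
  note sq = char_2_square_add [OF two] power_mult_distrib
  define u p where defs: "u = x1 + x3" "p = x1 * x3"
  have eqs: "p = (x0 + x2)^2" "s * u^2 = x0 * x2"
    using x by (simp_all add: defs)
  have dup: "(x0 + x2)^4 = p^2" "s * u^4 = x0 * x2 * u^2"
    unfolding eqs(1) eqs(2) [symmetric] by (simp_all add: power4_eq_xxxx power2_eq_square mult_ac)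
  \<comment> \<open>The expansion uses \<open>x1^3 + x3^3 = u^3 - 3 * p * u\<close>.\<close>
  have "x3 * (x0 * x3 + x1 * x2)^2 + x1 * (x0 * x1 + x2 * x3)^2
      = u * (x0^2 * u^2 + (x0^2 + x2^2) * p) - 2 * (2 * x0^2 * p * u)"
    unfolding sq by (simp add: defs algebra_simps power2_eq_square)
  also have "x0^2 + x2^2 = p"
    by (simp add: eqs sq)
  finally have "x3 * (x0 * x3 + x1 * x2)^2 + x1 * (x0 * x1 + x2 * x3)^2
      = u * (x0^2 * u^2 + p^2)"
    using two by (simp add: power2_eq_square)
  then have "u * x2 * p^2 + x2 * (x3 * (x0 * x3 + x1 * x2)^2 + x1 * (x0 * x1 + x2 * x3)^2)
      + u * x0 * (x0 * x2 * u^2) = 2 * (u * x2 * p^2 + u * x0^2 * x2 * u^2)"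
    by (simp add: algebra_simps power2_eq_square)
  then show ?thesis
    unfolding dup_forms_on_curve [OF two x] using two dup
    by (simp add: defs(1) [symmetric] algebra_simps)
qed

section \<open>Linear forms along a parametrisation\<close>

abbreviation linear :: "'a::field quad \<Rightarrow> 'a fps quad \<Rightarrow> 'a fps" where
  "linear l g \<equiv> dot (map_quad fps_const l) g"

text \<open>In total degree 1 exactly one exponent is 1; \<open>eval_form 1\<close> reads no other
  values.\<close>

fun linear_coeffs :: "'a quad \<Rightarrow> nat quad \<Rightarrow> 'a" where
  "linear_coeffs (l0, l1, l2, l3) (a, b, c, d) =
     (if a = 1 then l0 else if b = 1 then l1 else if c = 1 then l2 else l3)"

lemma exponents_1:
  "exponents 1 = {(1, 0, 0, 0), (0, 1, 0, 0), (0, 0, 1, 0), (0, 0, 0, 1)}"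
  unfolding exponents_def by auto

lemma eval_linear_form: "eval_form 1 (linear_coeffs l) g = linear l g"
  by (cases l; cases g) (simp add: exponents_1 [simplified] add.assoc)

lemma linear_nth_0:
  assumes "local_param s y g"
  shows "fps_nth (linear l g) 0 = dot l y"
  using assms by (cases l; cases g; cases y) (auto simp: local_param_def)

lemma has_ord_linear_0:
  assumes "local_param s y g" and "dot l y \<noteq> 0"
  shows "has_ord (linear l g) 0"
  using assms by (intro has_ord_0) (simp only: linear_nth_0 not_False_eq_True)

section \<open>The curve in characteristic 2\<close>

lemma nonsingular_imp_nonzero:
  fixes s :: "'a::field"
  assumes "nonsingular_curve s" and two: "(2::'a) = 0"
  shows "s \<noteq> 0"
proof
  assume "s = 0"
  \<comment> \<open>For \<open>s = 0\<close> this point lies on the curve and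
    \<open>gradient2\<close> vanishes there.\<close>
  then have "(0, 1, 0, 0) \<in> curve_coords s"
    by (simp add: curve_coords_def)
  then have "add_quad (scale a (gradient1 (0, 1, 0, 0))) (scale b (gradient2 s (0, 1, 0, 0)))
      = (0, 0, 0, 0) \<longrightarrow> a = 0 \<and> b = 0" for a b
    using assms(1) unfolding nonsingular_curve_def by blast
  from this [of 0 1] show False
    using two \<open>s = 0\<close> by simp
qed

context
  fixes s :: "'a::field"
  assumes two: "(2::'a) = 0" and s: "s \<noteq> 0"
begin

lemmas char2 = char_2_add_self [OF two]

lemma curve_nonzero:
  assumes "(x0, x1, x2, x3) \<in> curve_coords s"
  shows "x0 \<noteq> 0 \<or> x2 \<noteq> 0" "x1 \<noteq> 0 \<or> x3 \<noteq> 0"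
proof -
  show "x1 \<noteq> 0 \<or> x3 \<noteq> 0"
    using assms by (auto simp: curve_coords_def)
  show "x0 \<noteq> 0 \<or> x2 \<noteq> 0"
    using assms s by (auto simp: curve_coords_def)
qed

lemma neg_curve_coords: "x \<in> curve_coords s \<Longrightarrow> neg x \<in> curve_coords s"
  by (cases x) (auto simp: curve_coords_def algebra_simps)

text \<open>For \<open>x2 = 0\<close> the equations give \<open>x1 = x3\<close> and
  \<open>x0^2 = x1^2\<close>, and square roots are unique in characteristic 2.\<close>

lemma pt_eq_origin_iff:
  assumes "(x0, x1, x2, x3) \<in> curve_coords s"
  shows "pt (x0, x1, x2, x3) = origin \<longleftrightarrow> x2 = 0"
proof
  assume "x2 = 0"
  with assms s have eqs: "x0^2 = x1 * x3" "x1 + x3 = 0"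
    by (auto simp: curve_coords_def)
  then have "x1 = x3"
    by (simp add: char_2_add_eq_0_iff [OF two])
  then have "(x0 + x1)^2 = 0"
    unfolding char_2_square_add [OF two] using eqs by (simp add: power2_eq_square char2)
  then have "x0 = x1"
    by (simp add: char_2_add_eq_0_iff [OF two])
  moreover have "x0 \<noteq> 0"
    using curve_nonzero(1) [OF assms] \<open>x2 = 0\<close> by simp
  ultimately show "pt (x0, x1, x2, x3) = origin"
    using \<open>x2 = 0\<close> \<open>x1 = x3\<close> unfolding origin_def pt_eq_iff by (auto intro!: exI [of _ "1 / x0"])
qed (auto simp: origin_def pt_eq_iff)

text \<open>
  In characteristic 2 the two gradients involve disjoint pairs of coordinates, so the tangent
  line at \<open>y\<close> is spanned by \<open>(y0, 0, y2, 0)\<close> and \<open>(0, y1, 0, y3)\<close>.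
\<close>

lemma has_ord_linear_1:
  assumes y: "(y0, y1, y2, y3) \<in> curve_coords s"
    and g: "local_param s (y0, y1, y2, y3) g"
    and zero: "dot (l0, l1, l2, l3) (y0, y1, y2, y3) = 0"
    and transversal: "l0 * y0 + l2 * y2 \<noteq> 0"
  shows "has_ord (linear (l0, l1, l2, l3) g) 1"
proof -
  obtain g0 g1 g2 g3 where g_eq: "g = (g0, g1, g2, g3)" by (cases g)
  let ?v = "\<lambda>f. fps_nth f (Suc 0)"
  have at0: "fps_nth g0 0 = y0" "fps_nth g1 0 = y1" "fps_nth g2 0 = y2" "fps_nth g3 0 = y3"
    and velocity: "\<nexists>c. (?v g0, ?v g1, ?v g2, ?v g3) = (c * y0, c * y1, c * y2, c * y3)"
    and eqs: "(g0 + g2)^2 = g1 * g3" "fps_const s * (g1 + g3)^2 = g0 * g2"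
    using g by (auto simp: local_param_def g_eq)
  \<comment> \<open>Squares have no linear coefficient, so the equations force the velocity to be
    \<open>(a * y0, b * y1, a * y2, b * y3)\<close>; as it is nonzero in projective space,
    \<open>a \<noteq> b\<close>.\<close>
  have sq: "?v (f^2) = 0" for f :: "'a fps"
    by (simp add: power2_eq_square char2 mult.commute)
  from arg_cong [OF eqs(1), of ?v] have "y1 * ?v g3 = y3 * ?v g1"
    using at0 sq by (simp add: char_2_add_eq_0_iff [OF two] mult.commute)
  then obtain b where b: "?v g1 = b * y1" "?v g3 = b * y3"
    using curve_nonzero(2) [OF y] by (metis nonzero_mult_div_cancel_left times_divide_eq_left mult.commute)
  from arg_cong [OF eqs(2), of ?v] have "y0 * ?v g2 = y2 * ?v g0"
    using at0 sq by (simp add: char_2_add_eq_0_iff [OF two] mult.commute)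
  then obtain a where a: "?v g0 = a * y0" "?v g2 = a * y2"
    using curve_nonzero(1) [OF y] by (metis nonzero_mult_div_cancel_left times_divide_eq_left mult.commute)
  have "a \<noteq> b" using velocity a b by auto
  have "fps_nth (linear (l0, l1, l2, l3) g) 1 = (a - b) * (l0 * y0 + l2 * y2)
      + b * dot (l0, l1, l2, l3) (y0, y1, y2, y3)"
    by (simp add: g_eq a b algebra_simps)
  then show ?thesis
    using \<open>a \<noteq> b\<close> zero transversal linear_nth_0 [OF g] by (intro has_ord_1) auto
qed

text \<open>\<open>X1 + X3\<close> cuts out twice the points with \<open>X1 = X3\<close>, because on the curve
  \<open>X1 (X1 + X3) = (X0 + X1 + X2)\<^sup>2\<close>.\<close>

lemma has_ord_X1_X3:
  assumes y: "(y0, y1, y2, y3) \<in> curve_coords s" and "y1 = y3"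
    and g: "local_param s (y0, y1, y2, y3) (g0, g1, g2, g3)"
  shows "has_ord (g1 + g3) 2"
proof -
  have "y1 \<noteq> 0" using curve_nonzero(2) [OF y] \<open>y1 = y3\<close> by simp
  have "(y0 + y2)^2 = y1^2"
    using y \<open>y1 = y3\<close> by (simp add: curve_coords_def power2_eq_square)
  then have "(y0 + y2 + y1)^2 = 0"
    by (simp add: char_2_square_add [OF two] char2)
  then have *: "y0 + y2 = y1"
    by (simp add: char_2_add_eq_0_iff [OF two])
  have "has_ord (linear (1, 1, 1, 0) (g0, g1, g2, g3)) 1"
    using * \<open>y1 \<noteq> 0\<close> y g by (intro has_ord_linear_1) (auto simp: char2 add.commute add.left_commute)
  then have "has_ord ((g0 + g1 + g2)^2) (2 * 1)"
    by (intro has_ord_power2) simp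
  moreover have "(g0 + g1 + g2)^2 = g1 * (g1 + g3)"
  proof -
    have "(g0 + g2)^2 = g1 * g3" using g by (simp add: local_param_def)
    then show ?thesis
      using char_2_square_add [OF fps_2_eq_0 [OF two], of "g0 + g2" g1]
      by (simp add: algebra_simps power2_eq_square)
  qed
  moreover have "has_ord g1 0"
    using g \<open>y1 \<noteq> 0\<close> by (intro has_ord_0) (auto simp: local_param_def)
  ultimately show ?thesis
    using has_ord_cancel [of g1 "g1 + g3" 2 0] by simp
qed

text \<open>At O, \<open>X0\<close> is a unit and \<open>X1 + X3\<close> has order 2, so
  \<open>X0 X2 = s (X1 + X3)^2\<close> gives order 4.\<close>

lemma has_ord_X2:
  assumes y: "(y0, y1, y2, y3) \<in> curve_coords s"
    and g: "local_param s (y0, y1, y2, y3) (g0, g1, g2, g3)"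
  shows "has_ord g2 (4 * of_bool (y2 = 0))"
proof (cases "y2 = 0")
  case False
  then show ?thesis
    using g by (auto intro!: has_ord_0 simp: local_param_def)
next
  case True
  then have "y1 = y3" "y0 \<noteq> 0"
    using y s curve_nonzero(1) [OF y] char_2_add_eq_0_iff [OF two] by (auto simp: curve_coords_def)
  then have "has_ord (fps_const s * (g1 + g3)^2) (0 + 2 * 2)"
    using has_ord_X1_X3 [OF y _ g] s
    by (intro has_ord_mult has_ord_power2 has_ord_fps_const) auto
  moreover have "fps_const s * (g1 + g3)^2 = g0 * g2"
    using g by (simp add: local_param_def)
  moreover have "has_ord g0 0"
    using g \<open>y0 \<noteq> 0\<close> by (intro has_ord_0) (auto simp: local_param_def)
  ultimately show ?thesis
    using True has_ord_cancel [of g0 g2 4 0] by simp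
qed

text \<open>Vanishing of the chord fixes the ratio of \<open>X1 + X3\<close> to \<open>X2\<close>.
  After rescaling, the curve equations fix \<open>x0\<close> and \<open>x1 * x3\<close>, so
  \<open>x1\<close> and \<open>x3\<close> are determined up to order as the roots of a
  quadratic.\<close>

lemma dot_chord_eq_0_iff:
  assumes x: "(x0, x1, x2, x3) \<in> curve_coords s" and "x2 \<noteq> 0"
    and y: "(y0, y1, y2, y3) \<in> curve_coords s" and "y2 \<noteq> 0"
  shows "dot (chord (x0, x1, x2, x3)) (y0, y1, y2, y3) = 0 \<longleftrightarrow>
    pt (y0, y1, y2, y3) = pt (x0, x1, x2, x3) \<or> pt (y0, y1, y2, y3) = pt (neg (x0, x1, x2, x3))"
    (is "?L \<longleftrightarrow> ?R")
proof
  assume ?R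
  then obtain c where c: "c \<noteq> 0" "(x0, x1, x2, x3) = scale c (y0, y1, y2, y3) \<or>
      (x0, x3, x2, x1) = scale c (y0, y1, y2, y3)"
    unfolding pt_eq_iff by auto
  then show ?L
    by (auto simp: algebra_simps char2)
next
  assume ?L
  define c where "c = x2 / y2"
  have "c \<noteq> 0" using \<open>x2 \<noteq> 0\<close> \<open>y2 \<noteq> 0\<close> by (simp add: c_def)
  have c2: "x2 = c * y2" using \<open>y2 \<noteq> 0\<close> by (simp add: c_def)
  have "y2 * (c * (y1 + y3) + (x1 + x3)) = 0"
    using \<open>?L\<close> by (simp add: c2 algebra_simps)
  then have c13: "x1 + x3 = c * (y1 + y3)"
    using \<open>y2 \<noteq> 0\<close> by (simp add: char_2_add_eq_0_iff [OF two])
  have "x0 * x2 = s * (x1 + x3)^2"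
    using x by (simp add: curve_coords_def)
  also have "\<dots> = c^2 * (s * (y1 + y3)^2)"
    by (simp add: c13 power_mult_distrib)
  also have "\<dots> = c^2 * (y0 * y2)"
    using y by (simp add: curve_coords_def)
  finally have "x0 * x2 = c^2 * (y0 * y2)" .
  then have c0: "x0 = c * y0"
    using \<open>c \<noteq> 0\<close> \<open>y2 \<noteq> 0\<close> by (simp add: c2 power2_eq_square)
  have "x1 * x3 = (c * (y0 + y2))^2"
    using x by (simp add: curve_coords_def c0 c2 algebra_simps)
  also have "\<dots> = c^2 * (y1 * y3)"
    using y by (simp add: curve_coords_def power_mult_distrib)
  finally have "x1 * x3 = c^2 * (y1 * y3)" .
  moreover have "x3 = c * (y1 + y3) - x1" using c13 by (simp add: algebra_simps)
  ultimately have "(x1 - c * y1) * (x1 - c * y3) = 0"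
    by (simp add: algebra_simps power2_eq_square)
  then have "x1 = c * y1 \<or> x1 = c * y3" by simp
  then have "x1 = c * y1 \<and> x3 = c * y3 \<or> x1 = c * y3 \<and> x3 = c * y1"
    using c13 by (metis add.commute add_left_cancel distrib_left)
  then show ?R
    unfolding pt_eq_iff using \<open>c \<noteq> 0\<close> c0 c2 by auto
qed

section \<open>Orders of the planes at each point\<close>

lemma has_ord_chord:
  assumes x: "(x0, x1, x2, x3) \<in> curve_coords s" and "x2 \<noteq> 0"
    and y: "(y0, y1, y2, y3) \<in> curve_coords s"
    and g: "local_param s (y0, y1, y2, y3) g"
  shows "has_ord (linear (chord (x0, x1, x2, x3)) g)
    (2 * of_bool (y2 = 0) + of_bool (pt (y0, y1, y2, y3) = pt (x0, x1, x2, x3))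
      + of_bool (pt (y0, y1, y2, y3) = pt (neg (x0, x1, x2, x3))))"
proof -
  obtain g0 g1 g2 g3 where g_eq: "g = (g0, g1, g2, g3)" by (cases g)
  have at0: "fps_nth g0 0 = y0" "fps_nth g1 0 = y1" "fps_nth g2 0 = y2" "fps_nth g3 0 = y3"
    using g by (auto simp: local_param_def g_eq)
  show ?thesis
  proof (cases "y2 = 0")
    case True
    have not_eq: "pt (y0, y1, y2, y3) \<noteq> pt (x0, x1, x2, x3)"
        "pt (y0, y1, y2, y3) \<noteq> pt (neg (x0, x1, x2, x3))"
      using True \<open>x2 \<noteq> 0\<close> by (auto simp: pt_eq_iff)
    have "y1 = y3" "y0 \<noteq> 0"
      using True y s curve_nonzero(1) [OF y] char_2_add_eq_0_iff [OF two]
      by (auto simp: curve_coords_def)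
    have U: "has_ord (g1 + g3) 2"
      using has_ord_X1_X3 [OF y \<open>y1 = y3\<close>] g g_eq by simp
    \<comment> \<open>The unit \<open>g0\<close> brings in the product \<open>g0 * g2\<close>, so
      that \<open>g1 + g3\<close>, of order 2 at O, factors out with a unit cofactor.\<close>
    have "g0 * linear (chord (x0, x1, x2, x3)) g
        = fps_const x2 * g0 * (g1 + g3) + fps_const (x1 + x3) * (g0 * g2)"
      by (simp add: g_eq algebra_simps)
    also have "g0 * g2 = fps_const s * (g1 + g3)^2"
      using g by (simp add: local_param_def g_eq)
    finally have "g0 * linear (chord (x0, x1, x2, x3)) g
        = (fps_const x2 * g0 + fps_const (x1 + x3) * fps_const s * (g1 + g3)) * (g1 + g3)"
      by (simp only: power2_eq_square algebra_simps)
    moreover have "has_ord (fps_const x2 * g0 + fps_const (x1 + x3) * fps_const s * (g1 + g3)) 0"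
      using \<open>y1 = y3\<close> \<open>y0 \<noteq> 0\<close> \<open>x2 \<noteq> 0\<close> at0 by (intro has_ord_0) (simp add: char2)
    ultimately have "has_ord (g0 * linear (chord (x0, x1, x2, x3)) g) (0 + 2)"
      using U has_ord_mult by metis
    then have "has_ord (linear (chord (x0, x1, x2, x3)) g) (0 + 2 - 0)"
      by (rule has_ord_cancel) (simp add: has_ord_0 at0 \<open>y0 \<noteq> 0\<close>)
    then show ?thesis
      using True not_eq
      by (simp add: numeral_2_eq_2 del: dot.simps map_quad.simps chord.simps neg.simps)
  next
    case y2: False
    note iff = dot_chord_eq_0_iff [OF x \<open>x2 \<noteq> 0\<close> y y2]
    show ?thesis
    proof (cases "dot (chord (x0, x1, x2, x3)) (y0, y1, y2, y3) = 0")
      case False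
      then show ?thesis
        using iff y2 has_ord_linear_0 [OF g]
        by (simp del: dot.simps map_quad.simps chord.simps neg.simps)
    next
      case vanish: True
      show ?thesis
      \<comment> \<open>Here \<open>x1 = x3\<close> means \<open>P = -P\<close>: the chord is
        \<open>x2 (X1 + X3)\<close> and has order 2 at \<open>P\<close>. Otherwise it is transversal
        at \<open>P\<close> and \<open>-P\<close>.\<close>
      proof (cases "x1 = x3")
        case False
        have "pt (x0, x1, x2, x3) \<noteq> pt (neg (x0, x1, x2, x3))"
          using False \<open>x2 \<noteq> 0\<close> by (auto simp: pt_eq_iff)
        moreover have "has_ord (linear (chord (x0, x1, x2, x3)) g) 1"
          unfolding chord.simps using vanish False y2 two char_2_add_eq_0_iff [OF two]
          by (intro has_ord_linear_1 [OF y g]) simp_all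
        ultimately show ?thesis
          using iff vanish y2 by auto
      next
        case True
        then have "y1 = y3"
          using vanish \<open>x2 \<noteq> 0\<close>
          by (simp add: char2 distrib_left [symmetric] char_2_add_eq_0_iff [OF two])
        then have "has_ord (fps_const x2 * (g1 + g3)) (0 + 2)"
          using has_ord_X1_X3 [OF y] g g_eq \<open>x2 \<noteq> 0\<close>
          by (intro has_ord_mult has_ord_fps_const) auto
        then show ?thesis
          using iff vanish y2 True by (simp add: g_eq char2 distrib_left)
      qed
    qed
  qed
qed

text \<open>The forms have no common zero on the curve: if \<open>Z0\<close> and \<open>Z2\<close>
  vanish, then \<open>x0 = x2\<close> and \<open>x1 = x3\<close>, and the curve equations force
  \<open>x0 = x2 = 0\<close>.\<close>

lemma dup_forms_curve_coords:
  assumes "x \<in> curve_coords s"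
  shows "dup_forms s x \<in> curve_coords s"
proof -
  obtain x0 x1 x2 x3 where x_eq: "x = (x0, x1, x2, x3)" by (cases x)
  have x: "mu4_equations s (x0, x1, x2, x3)"
    using assms by (simp add: curve_coords_def x_eq)
  have "dup_forms s x \<noteq> (0, 0, 0, 0)"
  proof
    assume "dup_forms s x = (0, 0, 0, 0)"
    then have "x0 + x2 = 0" "x1 + x3 = 0"
      using s by (auto simp: x_eq)
    moreover from this have "x1 * x3 = 0" "x0 * x2 = 0"
      using x by simp_all
    ultimately have "x0 = 0" "x2 = 0"
      by auto
    then show False
      using curve_nonzero(1) [OF assms [unfolded x_eq]] by simp
  qed
  then show ?thesis
    using mu4_equations_dup_forms [OF two x] by (simp add: curve_coords_def x_eq)
qed

lemma has_ord_double_chord: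
  assumes x: "(x0, x1, x2, x3) \<in> curve_coords s" and "x2 \<noteq> 0"
    and y: "(y0, y1, y2, y3) \<in> curve_coords s"
    and g: "local_param s (y0, y1, y2, y3) g"
  defines "z \<equiv> dup_forms s (x0, x1, x2, x3)"
  shows "has_ord (linear (double_chord s (x0, x1, x2, x3)) g)
    (2 * of_bool (y2 = 0) + of_bool (pt (y0, y1, y2, y3) = pt z)
      + of_bool (pt (y0, y1, y2, y3) = pt (neg z)))"
proof -
  obtain z0 z1 z2 z3 where z_eq: "z = (z0, z1, z2, z3)" by (cases z)
  have z: "(z0, z1, z2, z3) \<in> curve_coords s"
    using dup_forms_curve_coords [OF x] by (simp only: z_def [symmetric] z_eq)
  have z2: "z2 = s * (x1 + x3)^4"
    using z_eq by (simp add: z_def)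
  obtain g0 g1 g2 g3 where g_eq: "g = (g0, g1, g2, g3)" by (cases g)
  show ?thesis
  proof (cases "x1 + x3 = 0")
    case True
    then have "z2 = 0" "x0 = 0"
      using x \<open>x2 \<noteq> 0\<close> by (auto simp: z2 curve_coords_def)
    then have "pt z = origin" "pt (neg z) = origin"
      using pt_eq_origin_iff [OF z] pt_eq_origin_iff [OF neg_curve_coords [OF z, simplified]]
      by (simp_all add: z_eq)
    \<comment> \<open>The plane degenerates to \<open>x2^2 X2\<close>; its order 4 at O is
      \<open>2 + 1 + 1\<close> because \<open>R = -R = O\<close>.\<close>
    moreover have "has_ord (linear (double_chord s (x0, x1, x2, x3)) g) (0 + 4 * of_bool (y2 = 0))"
    proof -
      have "has_ord (fps_const (x2^2) * g2) (0 + 4 * of_bool (y2 = 0))"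
        using has_ord_X2 [OF y] g \<open>x2 \<noteq> 0\<close> by (intro has_ord_mult has_ord_fps_const) (auto simp: g_eq)
      then show ?thesis
        using True \<open>x0 = 0\<close> by (simp add: g_eq)
    qed
    ultimately show ?thesis
      using pt_eq_origin_iff [OF y] by simp
  next
    case False
    then have "z2 \<noteq> 0" using s by (simp add: z2)
    have "linear (chord z) g = fps_const ((x1 + x3)^2) * linear (double_chord s (x0, x1, x2, x3)) g"
      unfolding z_def dup_forms_chord [OF two] by (simp add: g_eq algebra_simps)
    then have "has_ord (linear (double_chord s (x0, x1, x2, x3)) g)
      (2 * of_bool (y2 = 0) + of_bool (pt (y0, y1, y2, y3) = pt z)
        + of_bool (pt (y0, y1, y2, y3) = pt (neg z)) - 0)"
      using has_ord_chord [OF z \<open>z2 \<noteq> 0\<close> y g] False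
      by (intro has_ord_cancel [where f = "fps_const ((x1 + x3)^2)"] has_ord_fps_const)
        (simp_all only: z_eq, simp)
    then show ?thesis by simp
  qed
qed

lemma has_ord_tangent_plane:
  assumes x: "(x0, x1, x2, x3) \<in> curve_coords s" and "x2 \<noteq> 0"
    and y: "(y0, y1, y2, y3) \<in> curve_coords s"
    and g: "local_param s (y0, y1, y2, y3) g"
  defines "z \<equiv> dup_forms s (x0, x1, x2, x3)"
  shows "has_ord (linear (tangent_plane (x0, x1, x2, x3)) g)
    (of_bool (y2 = 0) + 2 * of_bool (pt (y0, y1, y2, y3) = pt (x0, x1, x2, x3))
      + of_bool (pt (y0, y1, y2, y3) = pt (neg z)))"
proof -
  let ?x = "(x0, x1, x2, x3)" and ?y = "(y0, y1, y2, y3)"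
  let ?F = "tangent_plane ?x" and ?F' = "tangent_plane (neg ?x)"
  obtain z0 z1 z2 z3 where z_eq: "z = (z0, z1, z2, z3)" by (cases z)
  have z: "(z0, z1, z2, z3) \<in> curve_coords s"
    using dup_forms_curve_coords [OF x] by (simp only: z_def [symmetric] z_eq)
  have z2: "z2 = s * (x1 + x3)^4"
    using z_eq by (simp add: z_def)
  obtain g0 g1 g2 g3 where g_eq: "g = (g0, g1, g2, g3)" by (cases g)
  show ?thesis
  proof (cases "x1 = x3")
    \<comment> \<open>Here \<open>P = -P\<close>, the tangent plane is \<open>x1\<close> times the
      chord, and \<open>-R = O\<close> accounts for the second intersection at O.\<close>
    case True
    then have "z2 = 0" by (simp add: z2 char2)
    then have "pt (neg z) = origin"
      using pt_eq_origin_iff [OF neg_curve_coords [OF z, simplified]] by (simp add: z_eq)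
    moreover have "x1 \<noteq> 0"
      using curve_nonzero(2) [OF x] True by simp
    then have "has_ord (fps_const x1 * linear (chord ?x) g)
        (0 + (2 * of_bool (y2 = 0) + of_bool (pt ?y = pt ?x) + of_bool (pt ?y = pt (neg ?x))))"
      by (intro has_ord_mult has_ord_fps_const has_ord_chord x y g \<open>x2 \<noteq> 0\<close>)
    moreover have "linear ?F g = fps_const x1 * linear (chord ?x) g"
      using True by (simp add: g_eq char2 algebra_simps)
    moreover have "neg ?x = ?x" using True by simp
    ultimately show ?thesis
      using pt_eq_origin_iff [OF y]
      by (cases "y2 = 0"; cases "pt ?y = pt ?x")
        (simp_all add: eval_nat_numeral
          del: dot.simps map_quad.simps chord.simps tangent_plane.simps neg.simps)
  next
    case False
    define u where "u = x1 + x3"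
    have "u \<noteq> 0" "x0 \<noteq> 0" "z2 \<noteq> 0"
      using False x s by (auto simp: u_def z2 curve_coords_def char_2_add_eq_0_iff [OF two])
    have ne: "pt ?y \<noteq> pt ?x" "pt ?y \<noteq> pt (neg ?x)" if "y1 = y3"
      using that False by (auto simp: pt_eq_iff)
    \<comment> \<open>The order of \<open>F F'\<close>: that of \<open>L^2 M\<close> minus the order
      4 of \<open>X2\<close> at O.\<close>
    let ?n = "2 * of_bool (pt ?y = pt ?x) + 2 * of_bool (pt ?y = pt (neg ?x)) + 2 * of_bool (y2 = 0)
      + of_bool (pt ?y = pt z) + of_bool (pt ?y = pt (neg z))"
    have total: "has_ord (linear ?F g * linear ?F' g) ?n"
    proof -
      have "linear ?F g * linear ?F' g * g2
          = (linear (chord ?x) g)^2 * linear (double_chord s ?x) g"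
        using tangent_plane_times_neg [OF fps_2_eq_0 [OF two], of "fps_const s" "fps_const x0"
            "fps_const x1" "fps_const x2" "fps_const x3" g0 g1 g2 g3] x g
        by (simp add: g_eq local_param_def curve_coords_def del: dot.simps)
      moreover have "has_ord ((linear (chord ?x) g)^2 * linear (double_chord s ?x) g)
        (2 * (2 * of_bool (y2 = 0) + of_bool (pt ?y = pt ?x) + of_bool (pt ?y = pt (neg ?x)))
          + (2 * of_bool (y2 = 0) + of_bool (pt ?y = pt z) + of_bool (pt ?y = pt (neg z))))"
        unfolding z_def by (intro has_ord_mult has_ord_power2 has_ord_chord has_ord_double_chord
            x y g \<open>x2 \<noteq> 0\<close>)
      moreover have "2 * (2 * a + b + c) + (2 * a + d + e)
          = (2 * b + 2 * c + 2 * a + d + e) + 4 * a" for a b c d e :: nat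
        by simp
      ultimately have "has_ord (g2 * (linear ?F g * linear ?F' g)) (?n + 4 * of_bool (y2 = 0))"
        by (simp only: mult.commute [of g2])
      from has_ord_cancel [OF this has_ord_X2 [OF y g [unfolded g_eq]]]
      show ?thesis by (simp only: diff_add_inverse2)
    qed
    show ?thesis
    proof (cases "y1 = y3")
      case True
      \<comment> \<open>\<open>pt y\<close> is \<open>O\<close> or the point of order 2, so the two planes meet the curve there in the same way.\<close>
      have same: "dot ?F' ?y = dot ?F ?y"
        using True by (simp add: algebra_simps)
      have "y0 * y2 = 0"
        using y True by (auto simp: curve_coords_def char2)
      then have "x2 * y0 + x0 * y2 \<noteq> 0"
        using curve_nonzero(1) [OF y] \<open>x0 \<noteq> 0\<close> \<open>x2 \<noteq> 0\<close> by auto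
      then have transversal: "(u * x2) * y0 + (u * x0) * y2 \<noteq> 0"
        using \<open>u \<noteq> 0\<close> by (simp add: mult.assoc distrib_left [symmetric])
      obtain n where n: "has_ord (linear ?F g) n" "has_ord (linear ?F' g) n"
      proof (cases "dot ?F ?y = 0")
        case True
        have F: "?F = (u * x2, x2 * x3, u * x0, x1 * x2)" "?F' = (u * x2, x2 * x1, u * x0, x3 * x2)"
          by (simp_all add: u_def add.commute)
        have "has_ord (linear ?F g) 1"
          using True transversal unfolding F by (intro has_ord_linear_1 [OF y g])
        moreover have "has_ord (linear ?F' g) 1"
          using same [unfolded True] transversal unfolding F
          by (intro has_ord_linear_1 [OF y g])
        ultimately show ?thesis by (rule that)
      next
        case False
        then show ?thesis
          using same
          by (intro that [of 0] has_ord_linear_0 [OF g]) (simp_all only: not_False_eq_True)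
      qed
      \<comment> \<open>A point with \<open>y1 = y3\<close> is its own negative, so it meets
        \<open>R\<close> and \<open>-R\<close> simultaneously; halving \<open>?n\<close> then gives
        \<open>n\<close>.\<close>
      have "pt ?y = pt z \<longleftrightarrow> pt ?y = pt (neg z)"
        using True by (auto simp: pt_eq_iff z_eq)
      moreover have "n + n = ?n"
        using has_ord_mult [OF n] total by (rule has_ord_unique)
      ultimately have "n = of_bool (y2 = 0) + 2 * of_bool (pt ?y = pt ?x)
          + of_bool (pt ?y = pt (neg z))"
        using ne [OF True] by (simp del: neg.simps)
      then show ?thesis
        using n(1) by (simp only:)
    next
      case False
      have "y2 \<noteq> 0"
        using False y by (auto simp: curve_coords_def s char_2_add_eq_0_iff [OF two])
      have "dot ?F ?y + dot ?F' ?y = x2 * u * (y1 + y3)"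
        by (simp add: u_def algebra_simps char2)
      moreover have "x2 * u * (y1 + y3) \<noteq> 0"
        using \<open>x2 \<noteq> 0\<close> \<open>u \<noteq> 0\<close> False by (simp add: char_2_add_eq_0_iff [OF two])
      ultimately have not_both: "dot ?F ?y \<noteq> 0 \<or> dot ?F' ?y \<noteq> 0"
        by (metis add_0)
      \<comment> \<open>\<open>F'\<close> is \<open>F\<close> composed with negation. So
        \<open>F\<close> vanishes at \<open>P\<close> and \<open>-R\<close>, and \<open>F'\<close>
        at \<open>-P\<close> and \<open>R\<close>, which assigns each term of \<open>?n\<close> to
        its plane.\<close>
      have F_neg: "dot ?F' (neg w) = dot ?F w" for w
        by (cases w) (simp add: algebra_simps)
      have Fx: "dot ?F ?x = 0"
        by (simp add: algebra_simps char2)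
      have Fz: "dot ?F (neg z) = 0"
        using tangent_plane_neg_dup [OF two] x by (simp add: z_def curve_coords_def)
      have "neg (neg z) = z" by (simp add: z_eq)
      then have F'z: "dot ?F' z = 0"
        using F_neg [of "neg z"] Fz by simp
      note vanish = dot_eq_0_cong [OF _ Fx] dot_eq_0_cong [OF _ Fz] dot_eq_0_cong [OF _ F'z]
        dot_eq_0_cong [OF _ F_neg [of ?x, unfolded Fx]]
      show ?thesis
      proof (cases "dot ?F ?y = 0")
        case True
        then have F': "dot ?F' ?y \<noteq> 0" using not_both by simp
        then have "has_ord (linear ?F' g) 0"
          by (rule has_ord_linear_0 [OF g])
        then have "has_ord (linear ?F g) ?n"
          using total has_ord_cancel [of "linear ?F' g" "linear ?F g" ?n 0]
          by (simp only: mult.commute [of "linear ?F g"] diff_zero)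
        moreover have "pt ?y \<noteq> pt (neg ?x)" "pt ?y \<noteq> pt z"
          using F' vanish by blast+
        ultimately show ?thesis
          using \<open>y2 \<noteq> 0\<close>
          by (simp del: dot.simps map_quad.simps tangent_plane.simps neg.simps)
      next
        case False
        then have "has_ord (linear ?F g) 0"
          by (rule has_ord_linear_0 [OF g])
        moreover have "pt ?y \<noteq> pt ?x" "pt ?y \<noteq> pt (neg z)"
          using False vanish by blast+
        ultimately show ?thesis
          using \<open>y2 \<noteq> 0\<close>
          by (simp del: dot.simps map_quad.simps tangent_plane.simps neg.simps)
      qed
    qed
  qed
qed

end

section \<open>The doubling divisor is principal\<close>

lemma is_double_dup_forms:
  fixes s :: "'a::alg_closed_field"
  assumes two: "(2::'a) = 0" and s: "s \<noteq> 0" and x: "x \<in> curve_coords s"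
  shows "is_double s (pt x) (pt (dup_forms s x))"
proof -
  obtain x0 x1 x2 x3 where x_eq: "x = (x0, x1, x2, x3)" by (cases x)
  define z where "z = dup_forms s x"
  have z: "z \<in> curve_coords s"
    unfolding z_def using two s x by (rule dup_forms_curve_coords)
  let ?D = "\<lambda>T. of_bool (T = pt x) + of_bool (T = pt x) - of_bool (T = pt z) - of_bool (T = origin) :: int"
  have "\<exists>l m. \<forall>y \<in> curve_coords s. \<forall>g. local_param s y g \<longrightarrow>
      linear l g \<noteq> 0 \<and> linear m g \<noteq> 0 \<and>
      ?D (pt y) = int (subdegree (linear l g)) - int (subdegree (linear m g))"
  proof (cases "x2 = 0")
    case True
    then have "pt x = origin"
      using pt_eq_origin_iff [OF two s] x by (simp add: x_eq)
    moreover have "x0 * x2 = s * (x1 + x3)^2"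
      using x by (simp add: x_eq curve_coords_def)
    then have "pt z = origin"
      using True s pt_eq_origin_iff [OF two s] z by (auto simp: z_def x_eq)
    \<comment> \<open>For \<open>P = R = O\<close> the divisor is zero, so \<open>X2\<close> serves
      as both numerator and denominator once it is known not to vanish identically.\<close>
    moreover have "linear (0, 0, 1, 0) g \<noteq> 0" if "y \<in> curve_coords s" "local_param s y g" for y g
    proof -
      obtain y0 y1 y2 y3 g0 g1 g2 g3 where "y = (y0, y1, y2, y3)" "g = (g0, g1, g2, g3)"
        by (cases y, cases g)
      then show ?thesis
        using has_ord_X2 [OF two s] that by (fastforce simp: has_ord_def)
    qed
    ultimately show ?thesis
      by (intro exI [of _ "(0, 0, 1, 0)"]) simp
  next
    case False
    \<comment> \<open>In the quotient \<open>-R\<close> and one copy of O cancel, leaving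
      \<open>2 P - R - O\<close>.\<close>
    have "linear (tangent_plane x) g \<noteq> 0 \<and> linear (double_chord s x) g \<noteq> 0 \<and>
        ?D (pt y) = int (subdegree (linear (tangent_plane x) g))
          - int (subdegree (linear (double_chord s x) g))"
      if y: "y \<in> curve_coords s" and g: "local_param s y g" for y g
    proof -
      obtain y0 y1 y2 y3 where y_eq: "y = (y0, y1, y2, y3)" by (cases y)
      note args = two s x [unfolded x_eq] False y [unfolded y_eq] g [unfolded y_eq]
      show ?thesis
        using has_ord_tangent_plane [OF args] has_ord_double_chord [OF args]
          pt_eq_origin_iff [OF two s y [unfolded y_eq]]
        unfolding has_ord_def x_eq [symmetric] y_eq [symmetric] z_def by simp
    qed
    then show ?thesis by blast
  qed
  then have "principal_divisor s ?D"
    unfolding principal_divisor_def eval_linear_form [symmetric] by blast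
  then show ?thesis
    using x z by (simp add: is_sum_def curve_points_def z_def)
qed

section \<open>The duplication program\<close>

text \<open>
  Two multiplications suffice because, with \<open>a = (x0 + x2)\<^sup>2\<close> and \<open>b = (x1 + x3)\<^sup>2\<close>, the curve
  equations give \<open>Z1 = (a + s b + (x0 + x3) (x1 + x2))\<^sup>2\<close> and \<open>Z3 = Z1 + a b\<close>.
  The registers are 8: \<open>a\<close>, 9: \<open>b\<close>, 10: \<open>Z0\<close>, 12: \<open>Z2\<close>, 17: \<open>Z1\<close>, 19: \<open>Z3\<close>.
\<close>

definition dup_prog :: quad_prog where
  "dup_prog =
    ([Add 0 2, Add 1 3, Add 0 3, Add 1 2,
      Sqr 4, Sqr 5, Sqr 8, Sqr 9,
      MulS 1 11, MulS 1 9,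
      Mul 6 7, Add 8 13, Add 14 15, Sqr 16,
      Mul 8 9, Add 17 18],
     (10, 17, 12, 19))"

lemma valid_dup_prog: "valid_quad_prog dup_prog"
  by (simp add: dup_prog_def)

lemma cost_dup_prog: "cost dup_prog = (2, 5, 2)"
  by (simp add: dup_prog_def)

lemma run_dup_prog:
  fixes s :: "'a::field"
  assumes two: "(2::'a) = 0"
  shows "run_quad s dup_prog x = dup_forms s x"
proof -
  obtain x0 x1 x2 x3 where x_eq: "x = (x0, x1, x2, x3)" by (cases x)
  note sq = char_2_square_add [OF two] power_mult_distrib
  define a b where "a = (x0 + x2)^2" and "b = (x1 + x3)^2"
  have 4: "(x0 + x2)^4 = a^2" "(x1 + x3)^4 = b^2"
    by (simp_all add: a_def b_def)
  have Z1: "((x0 + x3) * (x1 + x2) + (a + s * b))^2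
      = a^2 + s^2 * b^2 + (x0 + x3)^2 * (x1 + x2)^2"
    by (simp add: sq add.commute)
  \<comment> \<open>Squaring this relation shows that \<open>Z3\<close> differs from
    \<open>Z1\<close> by \<open>a * b\<close>.\<close>
  have "(x0 + x3) * (x1 + x2) + (x0 + x2) * (x1 + x3) = (x0 + x1) * (x2 + x3)"
    using two by (simp add: algebra_simps char_2_add_self [OF two])
  then have "((x0 + x3) * (x1 + x2))^2 + ((x0 + x2) * (x1 + x3))^2 = ((x0 + x1) * (x2 + x3))^2"
    by (simp add: char_2_square_add [OF two, symmetric])
  then have Z3: "(x0 + x3)^2 * (x1 + x2)^2 + a * b = (x0 + x1)^2 * (x2 + x3)^2"
    by (simp add: a_def b_def power_mult_distrib)
  have "run_quad s dup_prog x
      = (a^2, ((x0 + x3) * (x1 + x2) + (a + s * b))^2, s * b^2,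
         ((x0 + x3) * (x1 + x2) + (a + s * b))^2 + a * b)"
    by (simp add: x_eq dup_prog_def run_def a_def b_def nth_append)
  then show ?thesis
    unfolding Z1 using Z3 by (simp add: x_eq 4 add.assoc)
qed

section \<open>Passage to the algebraic closure\<close>

lemma curve_coords_to_ac:
  "map_quad to_ac x \<in> curve_coords (to_ac s) \<longleftrightarrow> x \<in> curve_coords s"
proof -
  obtain x0 x1 x2 x3 where "x = (x0, x1, x2, x3)" by (cases x)
  then show ?thesis
    by (simp add: curve_coords_def flip: to_ac_add to_ac_mult to_ac_power)
qed

lemma dup_forms_to_ac: "map_quad to_ac (dup_forms s x) = dup_forms (to_ac s) (map_quad to_ac x)"
  by (cases x) simp

theorem mainTheorem12:
  fixes s :: "'k::field"
  assumes "CHAR('k) = 2"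
    and "nonsingular_curve (to_ac s)"
  shows "(\<forall>x \<in> curve_coords (to_ac s).
            dup_forms (to_ac s) x \<in> curve_coords (to_ac s) \<and>
            is_double (to_ac s) (pt x) (pt (dup_forms (to_ac s) x))) \<and>
         (\<exists>prog. valid_quad_prog prog \<and> cost prog = (2, 5, 2) \<and>
            (\<forall>x \<in> curve_coords s.
               run_quad s prog x \<in> curve_coords s \<and>
               is_double (to_ac s) (pt (map_quad to_ac x))
                 (pt (map_quad to_ac (run_quad s prog x)))))"
proof -
  have two: "(2::'k) = 0"
    using of_nat_CHAR [where ?'a = 'k] assms(1) by simp
  then have two_ac: "(2::'k alg_closure) = 0"
    by (metis to_ac_0 to_ac_numeral)
  have s_ac: "to_ac s \<noteq> 0"
    using assms(2) two_ac by (rule nonsingular_imp_nonzero)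
  then have s: "s \<noteq> 0" by simp
  \<comment> \<open>Rational points are embedded into the closure, where \<open>is_double\<close> is
    defined; the forms commute with the embedding.\<close>
  have "\<forall>x \<in> curve_coords s. run_quad s dup_prog x \<in> curve_coords s \<and>
      is_double (to_ac s) (pt (map_quad to_ac x)) (pt (map_quad to_ac (run_quad s dup_prog x)))"
    using dup_forms_curve_coords [OF two s] is_double_dup_forms [OF two_ac s_ac]
    by (simp add: run_dup_prog [OF two] dup_forms_to_ac curve_coords_to_ac)
  then show ?thesis
    using dup_forms_curve_coords [OF two_ac s_ac] is_double_dup_forms [OF two_ac s_ac]
      valid_dup_prog cost_dup_prog by blast
qed

end
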